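(* Let $(A,\omega)$ be a commutative baric $K$-algebra satisfying $2x^{2}x^{4}=\omega(x)^{2}x^{4}+\omega(x)^{4}x^{2}$ for all $x\in A$, with Peirce decomposition $A=Ke\oplus A_0\oplus A_{\frac12}\oplus A_{\lambda}\oplus A_{\bar\lambda}$ relative to a non-zero idempotent $e$. If $A_{\frac12}=0$, then $A$ is a principal train algebra satisfying the equation $$x^5-\tfrac12\omega(x)x^4+\omega(x)^2x^3-\tfrac32\omega(x)^3x^2=0\quad\text{for all }x\in A.$$
   Context: $K$ is an algebraically closed (infinite, commutative) field of characteristic different from $2$. Algebras are commutative but not necessarily associative. A baric $K$-algebra $(A,\omega)$ is a $K$-algebra $A$ with a non-zero algebra homomorphism $\omega:A\to K$. Principal powers are $x^1=x$, $x^{k+1}=x\,x^{k}$. $(A,\omega)$ is a principal train algebra of rank $n\ge 2$ if there are $\gamma_1,\dots,\gamma_{n-1}\in K$ with $x^n+\gamma_1\omega(x)x^{n-1}+\dots+\gamma_{n-1}\omega(x)^{n-1}x=0$ for all $x\in A$, where $n\ge2$ is the smallest integer with this property; the proposition does not assert what the rank is. Here $\lambda=\frac{-1-i\sqrt{23}}{4}$, $\bar\lambda=\frac{-1+i\sqrt{23}}{4}$, where $i\sqrt{23}$ denotes a fixed square root of $-23$ in $K$, and for an idempotent $e$, $A_\alpha=\{x\in\ker\omega: ex=\alpha x\}$ for $\alpha\in\{0,\frac12,\lambda,\bar\lambda\}$.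
   Formalization: K is also assumed not to have characteristic 163: there the claim fails, e.g. for A = Ke+Ku+Kv with λ=31, e²=e, eu=31u, ev=31v, u²=v, all other products 0, ω(e)=1, ω(u)=ω(v)=0. *)

theory Defs
  imports "HOL-Computational_Algebra.Computational_Algebra"
    "HOL-Library.Product_Plus"
begin

locale commutative_algebra = vector_space scale
  for scale :: "'k::field \<Rightarrow> 'a::ab_group_add \<Rightarrow> 'a" +
  fixes mul :: "'a \<Rightarrow> 'a \<Rightarrow> 'a"
  assumes mul_commute: "mul x y = mul y x"
    and mul_add_left: "mul (x + y) z = mul x z + mul y z"
    and mul_scale_left: "mul (scale c x) y = scale c (mul x y)"

locale baric_algebra = commutative_algebra scale mul
  for scale :: "'k::field \<Rightarrow> 'a::ab_group_add \<Rightarrow> 'a"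
    and mul :: "'a \<Rightarrow> 'a \<Rightarrow> 'a" +
  fixes weight :: "'a \<Rightarrow> 'k"
  assumes weight_add: "weight (x + y) = weight x + weight y"
    and weight_scale: "weight (scale c x) = c * weight x"
    and weight_mul: "weight (mul x y) = weight x * weight y"
    and weight_nonzero: "\<exists>x. weight x \<noteq> 0"

text \<open>The algebra need not have a unit, so there is no zeroth principal power.\<close>

fun ppow :: "('a \<Rightarrow> 'a \<Rightarrow> 'a) \<Rightarrow> 'a \<Rightarrow> nat \<Rightarrow> 'a" where
  "ppow mul x 0 = undefined"
| "ppow mul x (Suc 0) = x"
| "ppow mul x (Suc (Suc k)) = mul x (ppow mul x (Suc k))"

definition train_identity ::
    "('k::field \<Rightarrow> 'a::ab_group_add \<Rightarrow> 'a) \<Rightarrow> ('a \<Rightarrow> 'a \<Rightarrow> 'a) \<Rightarrow> ('a \<Rightarrow> 'k) \<Rightarrow> nat \<Rightarrow> (nat \<Rightarrow> 'k) \<Rightarrow> bool" where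
  "train_identity scale mul weight n \<gamma> \<longleftrightarrow>
     (\<forall>x. ppow mul x n + (\<Sum>i = 1..n-1. scale (\<gamma> i * weight x ^ i) (ppow mul x (n - i))) = 0)"

definition principal_train_algebra_of_rank ::
    "('k::field \<Rightarrow> 'a::ab_group_add \<Rightarrow> 'a) \<Rightarrow> ('a \<Rightarrow> 'a \<Rightarrow> 'a) \<Rightarrow> ('a \<Rightarrow> 'k) \<Rightarrow> nat \<Rightarrow> bool" where
  "principal_train_algebra_of_rank scale mul weight n \<longleftrightarrow>
     baric_algebra scale mul weight \<and> 2 \<le> n \<and>
     (\<exists>\<gamma>. train_identity scale mul weight n \<gamma>) \<and>
     (\<forall>m. 2 \<le> m \<and> m < n \<longrightarrow> \<not> (\<exists>\<gamma>. train_identity scale mul weight m \<gamma>))"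

definition principal_train_algebra ::
    "('k::field \<Rightarrow> 'a::ab_group_add \<Rightarrow> 'a) \<Rightarrow> ('a \<Rightarrow> 'a \<Rightarrow> 'a) \<Rightarrow> ('a \<Rightarrow> 'k) \<Rightarrow> bool" where
  "principal_train_algebra scale mul weight \<longleftrightarrow>
     (\<exists>n. principal_train_algebra_of_rank scale mul weight n)"

definition peirce_space ::
    "('k::field \<Rightarrow> 'a::ab_group_add \<Rightarrow> 'a) \<Rightarrow> ('a \<Rightarrow> 'a \<Rightarrow> 'a) \<Rightarrow> ('a \<Rightarrow> 'k) \<Rightarrow> 'a \<Rightarrow> 'k \<Rightarrow> 'a set" where
  "peirce_space scale mul weight e \<alpha> = {x. weight x = 0 \<and> mul e x = scale \<alpha> x}"

text \<open>Since the summands are given as a list, a subspace occurring twice in it must be zero.\<close>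

definition is_direct_sum :: "'a::ab_group_add set list \<Rightarrow> bool" where
  "is_direct_sum Vs \<longleftrightarrow> (\<forall>x. \<exists>!vs. list_all2 (\<lambda>v V. v \<in> V) vs Vs \<and> sum_list vs = x)"

text \<open>
  The five-term decomposition is demanded to be direct even where the eigenvalues collide
  (\<^term>\<open>l = l'\<close> in characteristic 23, and one of \<^term>\<open>l\<close>, \<^term>\<open>l'\<close> is 0 in characteristic 3).
\<close>

definition peirce_decomposition ::
    "('k::field \<Rightarrow> 'a::ab_group_add \<Rightarrow> 'a) \<Rightarrow> ('a \<Rightarrow> 'a \<Rightarrow> 'a) \<Rightarrow> ('a \<Rightarrow> 'k) \<Rightarrow> 'a \<Rightarrow> 'k \<Rightarrow> 'k \<Rightarrow> bool" where
  "peirce_decomposition scale mul weight e l l' \<longleftrightarrow>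
     is_direct_sum [range (\<lambda>c. scale c e),
       peirce_space scale mul weight e 0,
       peirce_space scale mul weight e (1/2),
       peirce_space scale mul weight e l,
       peirce_space scale mul weight e l']"

text \<open>
  Characteristic 163. Linearising the weight-homogeneous identity at the idempotent gives, for
  eigenvectors \<open>x\<close>, \<open>y\<close> in the kernel of the weight, one scalar condition on each
  Peirce component of \<open>xy\<close>. For \<open>x\<close>, \<open>y\<close> in the \<open>l\<close>-space, the scalar at the \<open>l\<close>-component is
  \<open>23 - 6 l\<close>, which vanishes for a root \<open>l\<close> of \<open>2 l\<^sup>2 + l + 3\<close> only if 1304 = 8 * 163 is 0.
  In characteristic 163 (where \<open>l = 31\<close>, \<open>l' = 50\<close>) a square of an \<open>l\<close>-eigenvector need not vanish: the algebra
  with basis \<open>e, u, v\<close> and \<open>e e = e\<close>, \<open>e u = l u\<close>, \<open>e v = l v\<close>, \<open>u u = v\<close> and all other products 0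
  satisfies the identity and has the required Peirce decomposition, but not the train equation of
  degree 5. This is proved below; it is why characteristic 163 has to be excluded along with 2.
\<close>

definition scale163 :: "'k::field \<Rightarrow> 'k \<times> 'k \<times> 'k \<Rightarrow> 'k \<times> 'k \<times> 'k" where
  "scale163 t x = (case x of (a,b,c) \<Rightarrow> (t*a, t*b, t*c))"
definition mul163 :: "'k::field \<times> 'k \<times> 'k \<Rightarrow> 'k \<times> 'k \<times> 'k \<Rightarrow> 'k \<times> 'k \<times> 'k" where
  "mul163 x y = (case x of (a,b,c) \<Rightarrow> case y of (a',b',c') \<Rightarrow>
     (a*a', 31*(a*b'+b*a'), 31*(a*c'+c*a') + b*b'))"

lemma baric_algebra_163: "baric_algebra scale163 mul163 (fst :: 'k::field \<times> 'k \<times> 'k \<Rightarrow> 'k)"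
  by unfold_locales (auto simp: scale163_def mul163_def algebra_simps plus_prod_def split: prod.splits intro: exI[of _ 1])

lemma zero_char_163: assumes "CHAR('k::field) = 163" shows "(163::'k) = 0"
  using of_nat_CHAR[where 'a='k] assms by simp

lemma nonzero_char_163: assumes "CHAR('k::field) = 163" "\<not> 163 dvd n" shows "of_nat n \<noteq> (0::'k)"
  using assms of_nat_eq_0_iff_char_dvd[where 'a='k] by simp

lemma eq_mod_163: assumes "(163::'k::field) = 0" "(P::'k) = Q + 163 * t" shows "P = Q"
  using assms by simp

lemma ppow_unfold: "ppow m x 2 = m x x" "ppow m x 3 = m x (m x x)" "ppow m x 4 = m x (m x (m x x))"
  "ppow m x 5 = m x (m x (m x (m x x)))"
  by (simp_all add: eval_nat_numeral)

theorem train_equation_fails_in_char_163: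
  assumes C: "CHAR('k::alg_closed_field) = 163"
  shows "\<exists>(scale :: 'k \<Rightarrow> 'k \<times> 'k \<times> 'k \<Rightarrow> 'k \<times> 'k \<times> 'k) mul weight e s l l'.
     CHAR('k) \<noteq> 2 \<and> s ^ 2 = - 23 \<and> l = (- 1 - s) / 4 \<and> l' = (- 1 + s) / 4 \<and>
     baric_algebra scale mul weight \<and>
     (\<forall>x. scale 2 (mul (ppow mul x 2) (ppow mul x 4))
           = scale (weight x ^ 2) (ppow mul x 4) + scale (weight x ^ 4) (ppow mul x 2)) \<and>
     e \<noteq> 0 \<and> mul e e = e \<and>
     peirce_decomposition scale mul weight e l l' \<and>
     peirce_space scale mul weight e (1/2) = {0} \<and>
     \<not> (\<forall>x. ppow mul x 5 - scale (1/2 * weight x) (ppow mul x 4)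
         + scale (weight x ^ 2) (ppow mul x 3)
         - scale (3/2 * weight x ^ 3) (ppow mul x 2) = 0)"
proof -
  note z = zero_char_163[OF C]
  have two: "(2::'k) \<noteq> 0" and four: "(4::'k) \<noteq> 0"
    using nonzero_char_163[OF C, of 2] nonzero_char_163[OF C, of 4] by auto
  have half: "(1/2::'k) = 82" proof -
    have "(1::'k) = 82*2 - 163" by simp
    thus ?thesis using z two by (simp add: field_simps)
  qed
  have h32: "(3/2::'k) = 83" proof -
    have "(3::'k) = 83*2 - 163" by simp
    thus ?thesis using z two by (simp add: field_simps)
  qed
  have l: "(31::'k) = (- 1 - 38)/4" proof -
    have "(31::'k)*4 = (-1 - 38) + 163" by simp
    also have "\<dots> = -1 - 38" unfolding z by (rule add_0_right)
    finally show ?thesis unfolding nonzero_eq_divide_eq[OF four] .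
  qed
  have l': "(50::'k) = (- 1 + 38)/4" proof -
    have "(50::'k)*4 = (-1 + 38) + 163" by simp
    also have "\<dots> = -1 + 38" unfolding z by (rule add_0_right)
    finally show ?thesis unfolding nonzero_eq_divide_eq[OF four] .
  qed
  have s: "(38::'k)^2 = -23" proof -
    have "(38::'k)^2 = -23 + 9*163" by simp
    also have "\<dots> = -23" unfolding z by simp
    finally show ?thesis .
  qed
  have ident: "scale163 2 (mul163 (ppow mul163 x 2) (ppow mul163 x 4))
           = scale163 (fst x ^ 2) (ppow mul163 x 4) + scale163 (fst x ^ 4) (ppow mul163 x 2)" for x :: "'k \<times> 'k \<times> 'k"
  proof (cases x)
    case (fields a b c)
    show ?thesis unfolding fields ppow_unfold scale163_def mul163_def plus_prod_def prod.case fst_conv snd_conv prod.inject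
      apply (intro conjI)
        apply (simp add: algebra_simps power_numeral_reduce)
       apply (rule eq_mod_163[OF z, where t = "22692*a^5*b"], simp add: algebra_simps power_numeral_reduce)
      apply (rule eq_mod_163[OF z, where t = "22692*a^5*c + 47891*a^4*b^2"], simp add: algebra_simps power_numeral_reduce)
      done
  qed
  have p0: "peirce_space scale163 mul163 fst (1,0,0::'k) al = {0}" if "al - 31 \<noteq> 0" for al :: 'k
    using that by (auto simp: peirce_space_def scale163_def mul163_def zero_prod_def)
  have n: "(82::'k) - 31 \<noteq> 0" "(50::'k) - 31 \<noteq> 0" "(0::'k) - 31 \<noteq> 0"
    using nonzero_char_163[OF C, of 51] nonzero_char_163[OF C, of 19] nonzero_char_163[OF C, of 31] by simp_all
  have p1: "peirce_space scale163 mul163 fst (1,0,0::'k) 31 = {(0,b,c) |b c. True}"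
    by (auto simp: peirce_space_def scale163_def mul163_def)
  have dec: "peirce_decomposition scale163 mul163 fst (1,0,0::'k) 31 50"
    unfolding peirce_decomposition_def is_direct_sum_def half p0[OF n(1)] p0[OF n(2)] p0[OF n(3)] p1
  proof
    fix x :: "'k \<times> 'k \<times> 'k"
    obtain a b c where x: "x = (a,b,c)" by (cases x)
    show "\<exists>!vs. list_all2 (\<lambda>v V. v \<in> V) vs [range (\<lambda>c. scale163 c (1, 0, 0)), {0}, {0}, {(0, b, c) |b c. True}, {0}] \<and> sum_list vs = x"
      by (rule ex1I[of _ "[(a,0,0),0,(0,0,0),(0,b,c),0]"])
         (auto simp: x list_all2_Cons2 scale163_def plus_prod_def zero_prod_def)
  qed
  have fails: "\<not> (\<forall>x::'k \<times> 'k \<times> 'k. ppow mul163 x 5 - scale163 (1/2 * fst x) (ppow mul163 x 4)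
         + scale163 (fst x ^ 2) (ppow mul163 x 3)
         - scale163 (3/2 * fst x ^ 3) (ppow mul163 x 2) = 0)"
  proof
    assume A: "\<forall>x::'k \<times> 'k \<times> 'k. ppow mul163 x 5 - scale163 (1/2 * fst x) (ppow mul163 x 4)
         + scale163 (fst x ^ 2) (ppow mul163 x 3)
         - scale163 (3/2 * fst x ^ 3) (ppow mul163 x 2) = 0"
    have "(of_nat 186052 :: 'k) = 0" using A[rule_format, of "(1,1,0)"] unfolding half h32
      by (simp add: ppow_unfold scale163_def mul163_def plus_prod_def minus_prod_def zero_prod_def)
    thus False using nonzero_char_163[OF C, of 186052] by simp
  qed
  show ?thesis
    apply (rule exI[of _ scale163], rule exI[of _ mul163], rule exI[of _ fst], rule exI[of _ "(1,0,0)"],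
        rule exI[of _ 38], rule exI[of _ 31], rule exI[of _ 50])
    using s l l' baric_algebra_163 ident dec fails p0[OF n(1)] C
    by (auto simp: half mul163_def zero_prod_def)
qed

end

theory Submission
  imports Defs
begin

text \<open>
  Write \<open>A\<^sub>\<alpha>\<close> for the \<open>\<alpha>\<close>-eigenspace of multiplication by \<open>e\<close> inside the kernel of the weight.
  The idempotent has weight 1, and without an \<open>A\<^sub>1\<^sub>/\<^sub>2\<close> every element is \<open>w e + a + u + v\<close>
  with \<open>a \<in> A\<^sub>0\<close>, \<open>u \<in> A\<^sub>l\<close> and \<open>v \<in> A\<^sub>l\<^sub>'\<close>, where \<open>l, l'\<close> are the roots of
  \<open>2 X\<^sup>2 + X + 3\<close>. The train equation becomes a short computation once it is known how
  \<open>a\<close>, \<open>u\<close> and \<open>v\<close> multiply.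

  To find the products, put \<open>x = e + t y\<close> with \<open>y\<close> of weight 0 into the identity and compare the
  coefficients of \<open>t\<^sup>2\<close>, which is possible because the field is infinite
  (\<open>second_order_identity\<close>). Polarising for eigenvectors \<open>y\<^sub>1 \<in> A\<^sub>\<alpha>\<close>, \<open>y\<^sub>2 \<in> A\<^sub>\<beta>\<close> shows that the
  component of \<open>y\<^sub>1 y\<^sub>2\<close> in each \<open>A\<^sub>\<gamma>\<close> is annihilated by an explicit scalar in \<open>\<alpha>, \<beta>, \<gamma>\<close>
  (\<open>eigenvector_product_obstruction\<close>), hence vanishes whenever that scalar is not 0. To decide whether a
  scalar \<open>p + q l\<close> is nonzero, multiply it by its conjugate \<open>p + q l'\<close>: the product is an integer, and
  for the scalars that matter its only prime factors are 2 and 3, except for the \<open>A\<^sub>l\<close>-component of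
  \<open>A\<^sub>l A\<^sub>l\<close>, where it is \<open>16 \<cdot> 163\<close>. Characteristic 3 is harmless because there one of \<open>l, l'\<close> is 0, so that
  directness of the decomposition kills \<open>A\<^sub>0\<close> together with one of the other two spaces.

  The outcome is \<open>A\<^sub>0 A\<^sub>0 = A\<^sub>0 A\<^sub>l = A\<^sub>0 A\<^sub>l\<^sub>' = A\<^sub>l A\<^sub>l = A\<^sub>l\<^sub>' A\<^sub>l\<^sub>' = 0\<close> and \<open>A\<^sub>l A\<^sub>l\<^sub>' \<subseteq> A\<^sub>0\<close>. So
  all powers of \<open>x\<close> from the square on lie in the span of \<open>e\<close>, \<open>u\<close>, \<open>v\<close> and \<open>u v\<close>, on which
  multiplication by \<open>x\<close> is explicit (\<open>train_equation\<close>).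
\<close>

section \<open>Vector identities through linear functionals\<close>

lemma infinite_UNIV_alg_closed_field: "infinite (UNIV :: 'k::alg_closed_field set)"
proof
  assume fin: "finite (UNIV :: 'k set)"
  \<comment> \<open>Euclid's argument: 1 plus the product of all linear factors has no root.\<close>
  define P :: "'k poly" where "P = (\<Prod>a\<in>UNIV. [:- a, 1:])"
  have "degree P = card (UNIV :: 'k set)"
    unfolding P_def by (subst degree_prod_eq_sum_degree) auto
  then have "degree P > 0"
    using fin by (simp add: card_gt_0_iff)
  then have "degree (1 + P) > 0"
    by (subst degree_add_eq_right) simp_all
  then obtain x where "poly (1 + P) x = 0"
    using alg_closed_imp_poly_has_root by blast
  moreover have "poly P x = 0"
    using fin unfolding P_def poly_prod by (intro prod_zero) auto
  ultimately show False
    by simp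
qed

context vector_space
begin

text \<open>
  Linear functionals separate points: coordinates with respect to a basis do. A vector identity thereby
  turns into an identity between field elements, where ring normalisation applies; the rules for
  \<open>\<phi>\<close> are spelled out in the premise so that they can serve directly as rewrite rules.
\<close>

lemma eq_if_linear_functionals_eq:
  assumes "\<And>\<phi> :: 'b \<Rightarrow> 'a. \<lbrakk>\<And>x y. \<phi> (x + y) = \<phi> x + \<phi> y; \<And>x y. \<phi> (x - y) = \<phi> x - \<phi> y;
      \<And>x. \<phi> (- x) = - \<phi> x; \<phi> 0 = 0; \<And>c x. \<phi> (scale c x) = c * \<phi> x\<rbrakk> \<Longrightarrow> \<phi> v = \<phi> w"
  shows "v = w"
proof -
  define B where "B = extend_basis {}"
  have B: "independent B" "span B = UNIV"
    by (simp_all add: B_def independent_extend_basis independent_empty)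
  have "representation B v b = representation B w b" for b
    using B by (intro assms[of "\<lambda>v. representation B v b"])
      (simp_all add: representation_add representation_diff representation_neg representation_zero
        representation_scale)
  then have "representation B v = representation B w"
    by blast
  then show ?thesis
    using B sum_nonzero_representation_eq by (metis UNIV_I)
qed

text \<open>
  Under a linear functional a polynomial with vector coefficients becomes an ordinary one, and over an
  infinite field only the zero polynomial vanishes everywhere.
\<close>

lemma vector_polynomial_zero_coeffs:
  assumes inf: "infinite (UNIV :: 'a set)"
    and zero: "\<And>t. (\<Sum>i<n. scale (t ^ i) (c i)) = 0"
    and i: "i < n"
  shows "c i = 0"
proof (rule eq_if_linear_functionals_eq)
  fix \<phi> :: "'b \<Rightarrow> 'a"
  assume add: "\<And>x y. \<phi> (x + y) = \<phi> x + \<phi> y" and z: "\<phi> 0 = 0"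
    and scl: "\<And>c x. \<phi> (scale c x) = c * \<phi> x"
  have \<phi>_sum: "\<phi> (sum g A) = (\<Sum>i\<in>A. \<phi> (g i))" for g and A :: "nat set"
    by (induction A rule: infinite_finite_induct) (simp_all add: add z)
  define p where "p = (\<Sum>i<n. monom (\<phi> (c i)) i)"
  have "poly p t = \<phi> (\<Sum>i<n. scale (t ^ i) (c i))" for t
    by (simp add: p_def poly_sum poly_monom \<phi>_sum scl mult.commute)
  then have "poly p t = 0" for t
    by (simp add: zero z)
  then have "p = 0"
    using poly_roots_finite[of p] inf by auto
  moreover have "coeff p i = \<phi> (c i)"
    using i by (simp add: p_def coeff_sum)
  ultimately show "\<phi> (c i) = \<phi> 0"
    by (simp add: z)
qed

end

context commutative_algebra
begin

lemma mul_add_right: "mul z (x + y) = mul z x + mul z y"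
  using mul_add_left[of x y z] by (simp add: mul_commute)

lemma mul_scale_right: "mul y (scale c x) = scale c (mul y x)"
  using mul_scale_left[of c x y] by (simp add: mul_commute)

lemma mul_zero_left [simp]: "mul 0 x = 0"
  using mul_add_left[of 0 0 x] by simp

lemma mul_zero_right [simp]: "mul x 0 = 0"
  by (simp add: mul_commute[of x])

lemmas mul_linear = mul_add_left mul_add_right mul_scale_left mul_scale_right

end

lemma (in baric_algebra) weight_zero [simp]: "weight 0 = 0"
  using weight_scale[of 0 0] by simp

section \<open>The second-order part of the identity at an idempotent\<close>

text \<open>
  The scalar with which the \<open>\<gamma>\<close>-component of a product \<open>y\<^sub>1 y\<^sub>2\<close>, for \<open>y\<^sub>1\<close> and \<open>y\<^sub>2\<close> in the eigenspaces of
  \<open>\<alpha>\<close> and \<open>\<beta>\<close>, enters the polarised second-order part of the identity.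
\<close>

definition peirce_obstruction :: "'k::field \<Rightarrow> 'k \<Rightarrow> 'k \<Rightarrow> 'k" where
  "peirce_obstruction \<alpha> \<beta> \<gamma> =
     (2 * \<gamma> - 1) * (2 * \<gamma>^2 + 2 * (\<alpha> + \<beta>) * \<gamma> + \<alpha> + \<beta> + 2 * \<alpha>^2 + 2 * \<beta>^2 + 2)
     + 4 * \<alpha> * \<beta> * (2 + \<alpha> + \<beta> + 2 * \<alpha>^2 + 2 * \<beta>^2)"

locale baric_2_4_algebra = baric_algebra scale mul weight
  for scale :: "'k::field \<Rightarrow> 'a::ab_group_add \<Rightarrow> 'a" and mul and weight +
  fixes e :: 'a
  assumes infinite_field: "infinite (UNIV :: 'k set)"
    and identity: "\<And>x. scale 2 (mul (ppow mul x 2) (ppow mul x 4))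
           = scale (weight x ^ 2) (ppow mul x 4) + scale (weight x ^ 4) (ppow mul x 2)"
    and idempotent: "mul e e = e"
    and weight_e: "weight e = 1"
begin

text \<open>
  This is the coefficient of \<open>t\<^sup>2\<close> in the identity for \<open>x = e + t y\<close>. The vectors \<open>a\<^sub>i\<close>, \<open>b\<^sub>i\<close>, \<open>c\<^sub>i\<close>
  are the coefficients of \<open>t\<^sup>i\<close> in the second, third and fourth principal power of \<open>x\<close>.
\<close>

lemma second_order_identity:
  assumes "weight y = 0"
  defines "a1 \<equiv> scale 2 (mul e y)" and "a2 \<equiv> mul y y"
  defines "b1 \<equiv> mul e a1 + mul e y" and "b2 \<equiv> mul e a2 + mul y a1"
  defines "c1 \<equiv> mul e b1 + mul e y" and "c2 \<equiv> mul e b2 + mul y b1"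
  shows "scale 2 (mul e c2 + mul a1 c1 + mul e a2) - c2 - a2 = 0"
proof -
  define b3 c3 c4 where "b3 = mul y a2" and "c3 = mul e b3 + mul y b2" and "c4 = mul y b3"
  \<comment> \<open>All seven coefficients of the identity; only the one at index 2 is wanted.\<close>
  define k where "k i = [0, scale 2 (mul e c1 + mul e a1) - c1 - a1,
      scale 2 (mul e c2 + mul a1 c1 + mul e a2) - c2 - a2,
      scale 2 (mul e c3 + mul a1 c2 + mul a2 c1) - c3,
      scale 2 (mul e c4 + mul a1 c3 + mul a2 c2) - c4,
      scale 2 (mul a1 c4 + mul a2 c3), scale 2 (mul a2 c4)] ! i" for i
  have "(\<Sum>i<7. scale (t ^ i) (k i)) = 0" for t
  proof -
    define x where "x = e + scale t y"
    have w: "weight x = 1"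
      by (simp add: x_def weight_add weight_scale weight_e assms(1))
    have x2: "mul x x = e + scale t a1 + scale (t^2) a2"
      unfolding x_def a1_def a2_def mul_linear idempotent mul_commute[of y e]
      by (rule eq_if_linear_functionals_eq) (simp add: algebra_simps power2_eq_square)
    have x3: "mul x (mul x x) = e + scale t b1 + scale (t^2) b2 + scale (t^3) b3"
      unfolding x2 unfolding x_def b1_def b2_def b3_def mul_linear idempotent mul_commute[of y e]
      by (rule eq_if_linear_functionals_eq) (simp add: algebra_simps eval_nat_numeral)
    have x4: "mul x (mul x (mul x x)) = e + scale t c1 + scale (t^2) c2 + scale (t^3) c3 + scale (t^4) c4"
      unfolding x3 unfolding x_def c1_def c2_def c3_def c4_def mul_linear idempotent mul_commute[of y e]
      by (rule eq_if_linear_functionals_eq) (simp add: algebra_simps eval_nat_numeral)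
    have "0 = scale 2 (mul (mul x x) (mul x (mul x (mul x x)))) - mul x (mul x (mul x x)) - mul x x"
      using identity[of x] by (simp add: ppow_unfold w)
    also have "\<dots> = (\<Sum>i<7. scale (t ^ i) (k i))"
      unfolding x4 unfolding x2 k_def mul_linear idempotent mul_commute[of a1 e] mul_commute[of a2 e]
    proof (rule eq_if_linear_functionals_eq, goal_cases)
      case (1 \<phi>)
      show ?case
        by (simp add: 1 eval_nat_numeral algebra_simps)
    qed
    finally show ?thesis ..
  qed
  from vector_polynomial_zero_coeffs[OF infinite_field this, of 2] show ?thesis
    by (simp add: k_def)
qed

text \<open>
  The second-order part \<open>Q\<close> is quadratic in \<open>y\<close>, so \<open>Q(y\<^sub>1 + y\<^sub>2) - Q(y\<^sub>1) - Q(y\<^sub>2)\<close> involves only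
  \<open>y\<^sub>1 y\<^sub>2\<close> and its images under multiplication by \<open>e\<close>. The case \<open>y\<^sub>1 = y\<^sub>2\<close> is included.
\<close>

lemma eigenvector_product_obstruction:
  assumes w: "weight y1 = 0" "weight y2 = 0"
    and y: "mul e y1 = scale \<alpha> y1" "mul e y2 = scale \<beta> y2"
    and "mul y1 y2 = z0 + z1 + z2"
    and z: "mul e z0 = scale \<gamma>0 z0" "mul e z1 = scale \<gamma>1 z1" "mul e z2 = scale \<gamma>2 z2"
  shows "scale (peirce_obstruction \<alpha> \<beta> \<gamma>0) z0 + scale (peirce_obstruction \<alpha> \<beta> \<gamma>1) z1
    + scale (peirce_obstruction \<alpha> \<beta> \<gamma>2) z2 = 0"
proof -
  have w12: "weight (y1 + y2) = 0"
    by (simp add: weight_add w)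
  have z12: "mul y1 y2 = z0 + z1 + z2" "mul y2 y1 = z0 + z1 + z2"
    using assms(5) by (simp_all add: mul_commute)
  note second = second_order_identity[OF w12] second_order_identity[OF w(1)] second_order_identity[OF w(2)]
  show ?thesis
  proof (rule eq_if_linear_functionals_eq)
    fix \<phi> :: "'a \<Rightarrow> 'k"
    assume \<phi>: "\<And>x y. \<phi> (x + y) = \<phi> x + \<phi> y" "\<And>x y. \<phi> (x - y) = \<phi> x - \<phi> y"
      "\<And>x. \<phi> (- x) = - \<phi> x" "\<phi> 0 = 0" "\<And>c x. \<phi> (scale c x) = c * \<phi> x"
    note \<phi>_second = second[THEN arg_cong[where f = \<phi>], unfolded mul_linear y z12 z \<phi>]
    show "\<phi> (scale (peirce_obstruction \<alpha> \<beta> \<gamma>0) z0 + scale (peirce_obstruction \<alpha> \<beta> \<gamma>1) z1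
        + scale (peirce_obstruction \<alpha> \<beta> \<gamma>2) z2) = \<phi> 0"
      unfolding \<phi> peirce_obstruction_def using \<phi>_second by algebra
  qed
qed

end

section \<open>Products of Peirce components\<close>

text \<open>
  The eigenvalues enter only through their sum and product, which makes the assumptions symmetric in
  \<open>l\<close> and \<open>l'\<close>.
\<close>

locale half_free_2_4_algebra = baric_2_4_algebra scale mul weight e
  for scale :: "'k::field \<Rightarrow> 'a::ab_group_add \<Rightarrow> 'a" and mul and weight and e +
  fixes l l' :: 'k
  assumes two_nonzero: "(2::'k) \<noteq> 0" and nonzero_163: "(163::'k) \<noteq> 0"
    and eigenvalue_sum: "2 * (l + l') = - 1" and eigenvalue_product: "2 * (l * l') = 3"
    and kernel_decomposition: "\<And>x. weight x = 0 \<Longrightarrow> \<exists>a u v. mul e a = 0 \<and> mul e u = scale l u \<and>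
       mul e v = scale l' v \<and> weight a = 0 \<and> weight u = 0 \<and> weight v = 0 \<and> x = a + u + v"
    and kernel_independent: "\<And>a u v. \<lbrakk>mul e a = 0; mul e u = scale l u; mul e v = scale l' v;
       weight a = 0; weight u = 0; weight v = 0; a + u + v = 0\<rbrakk> \<Longrightarrow> a = 0 \<and> u = 0 \<and> v = 0"
begin

lemma swapped_eigenvalues: "half_free_2_4_algebra scale mul weight e l' l"
proof unfold_locales
  show "2 * (l' + l) = - 1" "2 * (l' * l) = 3"
    using eigenvalue_sum eigenvalue_product by (simp_all add: ac_simps)
  show "\<exists>a u v. mul e a = 0 \<and> mul e u = scale l' u \<and> mul e v = scale l v \<and>
      weight a = 0 \<and> weight u = 0 \<and> weight v = 0 \<and> x = a + u + v" if x: "weight x = 0" for x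
  proof -
    obtain a u v where "mul e a = 0" "mul e u = scale l u" "mul e v = scale l' v"
        "weight a = 0" "weight u = 0" "weight v = 0" "x = a + u + v"
      using kernel_decomposition[OF x] by blast
    moreover from this have "x = a + v + u"
      by (simp add: ac_simps)
    ultimately show ?thesis
      by blast
  qed
  show "a = 0 \<and> u = 0 \<and> v = 0"
    if "mul e a = 0" "mul e u = scale l' u" "mul e v = scale l v" "weight a = 0" "weight u = 0"
      "weight v = 0" "a + u + v = 0" for a u v
    using kernel_independent[of a v u] that by (simp add: ac_simps)
qed (fact two_nonzero nonzero_163)+

text \<open>
  When two eigenvalues agree, a common eigenvector \<open>x\<close> gives the two decompositions \<open>x + (- x) = 0\<close>
  and \<open>0 + 0 = 0\<close>, which directness does not allow unless \<open>x = 0\<close>.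
\<close>

lemma eigenvalue_collision:
  assumes x: "mul e x = 0" "weight x = 0" and l: "l = 0 \<or> l' = 0"
  shows "x = 0"
proof -
  have neg: "mul e (- x) = 0" "weight (- x) = 0"
    using mul_scale_right[of e "- 1" x] weight_scale[of "- 1" x] x by simp_all
  from l show ?thesis
  proof
    assume "l = 0"
    then show ?thesis
      using kernel_independent[of x "- x" 0, OF x(1) _ _ x(2) neg(2) weight_zero] neg(1) by simp
  next
    assume "l' = 0"
    then show ?thesis
      using kernel_independent[of x 0 "- x", OF x(1) _ _ x(2) weight_zero neg(2)] neg(1) by simp
  qed
qed

text \<open>
  In characteristic 3 several scalars below vanish; the next three lemmas replace them by the collapse of
  the eigenspaces themselves.
\<close>

lemma char_3_eigenvalue_zero:
  assumes "(3::'k) = 0"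
  shows "l = 0 \<or> l' = 0"
proof -
  have "2 * (l * l') = 0"
    using eigenvalue_product assms by (rule trans)
  then show ?thesis
    using two_nonzero unfolding mult_eq_0_iff by blast
qed

lemma char_3_kernel_zero:
  assumes "(3::'k) = 0" "mul e a = 0" "weight a = 0"
  shows "a = 0"
  using eigenvalue_collision[OF assms(2,3) char_3_eigenvalue_zero[OF assms(1)]] .

lemma char_3_eigenvector_zero:
  assumes "(3::'k) = 0" "mul e u = scale l u" "weight u = 0" "mul e v = scale l' v" "weight v = 0"
  shows "u = 0 \<or> v = 0"
proof -
  have "mul e u = 0 \<or> mul e v = 0"
    using char_3_eigenvalue_zero[OF assms(1)] assms(2,4) by (metis scale_zero_left)
  then show ?thesis
    using char_3_kernel_zero[OF assms(1)] assms(3,5) by blast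
qed

text \<open>
  Directness separates the relation of \<open>eigenvector_product_obstruction\<close> into one condition on each
  component.
\<close>

lemma eigenvector_product_components:
  assumes "weight x = 0" "weight y = 0" "mul e x = scale \<alpha> x" "mul e y = scale \<beta> y"
  obtains a u v where "mul x y = a + u + v" "mul e a = 0" "mul e u = scale l u" "mul e v = scale l' v"
    "weight a = 0" "weight u = 0" "weight v = 0"
    "peirce_obstruction \<alpha> \<beta> 0 = 0 \<or> a = 0" "peirce_obstruction \<alpha> \<beta> l = 0 \<or> u = 0"
    "peirce_obstruction \<alpha> \<beta> l' = 0 \<or> v = 0"
proof -
  have "weight (mul x y) = 0"
    by (simp add: weight_mul assms)
  then obtain a u v where auv: "mul e a = 0" "mul e u = scale l u" "mul e v = scale l' v"
      "weight a = 0" "weight u = 0" "weight v = 0" "mul x y = a + u + v"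
    using kernel_decomposition by blast
  have "scale (peirce_obstruction \<alpha> \<beta> 0) a + scale (peirce_obstruction \<alpha> \<beta> l) u
      + scale (peirce_obstruction \<alpha> \<beta> l') v = 0"
    using auv by (intro eigenvector_product_obstruction[OF assms]) simp_all
  then have "scale (peirce_obstruction \<alpha> \<beta> 0) a = 0 \<and> scale (peirce_obstruction \<alpha> \<beta> l) u = 0 \<and>
      scale (peirce_obstruction \<alpha> \<beta> l') v = 0"
    using auv by (intro kernel_independent)
      (simp_all add: mul_scale_right weight_scale scale_left_commute)
  then show ?thesis
    using that[of a u v] auv by (simp only: scale_eq_0_iff)
qed

lemma nonzero_power_two_times_three:
  assumes "(3::'k) \<noteq> 0" "c = 2 ^ m * 3 ^ n"
  shows "c \<noteq> (0::'k)"
  using assms two_nonzero by simp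

text \<open>
  The values of the obstruction, reduced modulo \<open>2 l\<^sup>2 + l + 3\<close>.
\<close>

lemma obstruction_A0_A0:
  "peirce_obstruction 0 0 0 = (- 2 :: 'k)" "peirce_obstruction 0 0 l = 4" "peirce_obstruction 0 0 l' = 4"
proof -
  show "peirce_obstruction 0 0 0 = (- 2 :: 'k)"
    by (simp add: peirce_obstruction_def)
next
  show "peirce_obstruction 0 0 l = 4" "peirce_obstruction 0 0 l' = 4"
    unfolding peirce_obstruction_def mult_zero_left mult_zero_right zero_power2 add_0 add_0_right
    by - (use eigenvalue_sum eigenvalue_product in algebra)+
qed

lemma obstruction_A0_Al:
  "peirce_obstruction 0 l 0 = 1" "peirce_obstruction 0 l l = 13 - 10 * l" "peirce_obstruction 0 l l' = 4"
  unfolding peirce_obstruction_def mult_zero_left mult_zero_right zero_power2 add_0 add_0_right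
  by - (use eigenvalue_sum eigenvalue_product in algebra)+

lemma obstruction_Al_Al:
  "peirce_obstruction l l 0 = 28 + 8 * l" "peirce_obstruction l l l = 46 - 12 * l"
  "peirce_obstruction l l l' = 28 + 8 * l"
  unfolding peirce_obstruction_def mult_zero_left mult_zero_right zero_power2 add_0 add_0_right
  by - (use eigenvalue_sum eigenvalue_product in algebra)+

lemma four_nonzero: "(4::'k) \<noteq> 0"
  using two_nonzero by (metis mult_2 mult_eq_0_iff numeral_Bit0)

lemma A0_A0_zero:
  assumes a: "mul e a = 0" "weight a = 0" and b: "mul e b = 0" "weight b = 0"
  shows "mul a b = 0"
proof -
  have "mul e a = scale 0 a" "mul e b = scale 0 b"
    using a b by simp_all
  from eigenvector_product_components[OF a(2) b(2) this]
  obtain c u v where "mul a b = c + u + v" "- 2 = (0::'k) \<or> c = 0" "4 = (0::'k) \<or> u = 0"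
      "4 = (0::'k) \<or> v = 0"
    unfolding obstruction_A0_A0 by blast
  then show ?thesis
    using two_nonzero four_nonzero by simp
qed

lemma A0_Al_zero:
  assumes a: "mul e a = 0" "weight a = 0" and u: "mul e u = scale l u" "weight u = 0"
  shows "mul a u = 0"
proof (cases "(3::'k) = 0")
  case True
  then show ?thesis
    using char_3_kernel_zero[OF True a] by simp
next
  case False
  \<comment> \<open>The norm of the scalar at the \<open>l\<close>-component.\<close>
  have "(13 - 10 * l) * (13 - 10 * l') = 2 ^ 7 * 3 ^ 1"
    using eigenvalue_sum eigenvalue_product by algebra
  then have "13 - 10 * l \<noteq> 0"
    using nonzero_power_two_times_three[OF False, of _ 7 1] by fastforce
  have "mul e a = scale 0 a"
    using a by simp
  from eigenvector_product_components[OF a(2) u(2) this u(1)]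
  obtain c p q where "mul a u = c + p + q" "1 = (0::'k) \<or> c = 0" "13 - 10 * l = 0 \<or> p = 0"
      "4 = (0::'k) \<or> q = 0"
    unfolding obstruction_A0_Al by blast
  then show ?thesis
    using \<open>13 - 10 * l \<noteq> 0\<close> four_nonzero by simp
qed

text \<open>
  The norm \<open>16 \<cdot> 163\<close> of the scalar at the \<open>l\<close>-component is where characteristic 163 has to be
  excluded. Squares are all that is used of \<open>A\<^sub>l A\<^sub>l\<close>, since an
  element has a single component \<open>u \<in> A\<^sub>l\<close>.
\<close>

lemma Al_square_zero:
  assumes u: "mul e u = scale l u" "weight u = 0"
  shows "mul u u = 0"
proof -
  have "(46 - 12 * l) * (46 - 12 * l') = 2 ^ 4 * 163"
    using eigenvalue_sum eigenvalue_product by algebra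
  moreover have "(2::'k) ^ 4 * 163 \<noteq> 0"
    using two_nonzero nonzero_163 by (simp only: mult_eq_0_iff power_eq_0_iff) blast
  ultimately have n1: "46 - 12 * l \<noteq> 0"
    by fastforce
  from eigenvector_product_components[OF u(2,2,1,1)]
  obtain a b c where abc: "mul u u = a + b + c" "mul e a = 0" "mul e c = scale l' c"
    "weight a = 0" "weight c = 0" "28 + 8 * l = 0 \<or> a = 0" "46 - 12 * l = 0 \<or> b = 0" "28 + 8 * l = 0 \<or> c = 0"
    unfolding obstruction_Al_Al by blast
  have b: "b = 0"
    using abc(7) n1 by blast
  show ?thesis
  proof (cases "(3::'k) = 0")
    case True
    have "a = 0" "u = 0 \<or> c = 0"
      using char_3_kernel_zero[OF True abc(2,4)] char_3_eigenvector_zero[OF True u abc(3,5)] by blast+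
    then show ?thesis
      using abc(1) b by fastforce
  next
    case False
    have "(28 + 8 * l) * (28 + 8 * l') = 2 ^ 8 * 3 ^ 1"
      using eigenvalue_sum eigenvalue_product by algebra
    then have "28 + 8 * l \<noteq> 0"
      using nonzero_power_two_times_three[OF False, of _ 8 1] by fastforce
    then show ?thesis
      using abc b by simp
  qed
qed

lemma obstruction_Al_Al'_nonzero:
  assumes "(3::'k) \<noteq> 0"
  shows "peirce_obstruction l l' l \<noteq> 0"
proof -
  have "peirce_obstruction l l' l = - (10 * l + 11)"
    unfolding peirce_obstruction_def using eigenvalue_sum eigenvalue_product by algebra
  moreover have "(10 * l + 11) * (10 * l' + 11) = 2 ^ 3 * 3 ^ 3"
    using eigenvalue_sum eigenvalue_product by algebra
  then have "10 * l + 11 \<noteq> 0"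
    using nonzero_power_two_times_three[OF assms, of _ 3 3] by fastforce
  ultimately show ?thesis
    by (simp only: neg_equal_0_iff_equal not_False_eq_True)
qed

end

context half_free_2_4_algebra
begin

text \<open>Statements about \<open>A\<^sub>l\<close> transfer to \<open>A\<^sub>l\<^sub>'\<close> along the exchange of the two roots.\<close>

interpretation swap: half_free_2_4_algebra scale mul weight e l' l
  by (fact swapped_eigenvalues)

lemma peirce_obstruction_commute: "peirce_obstruction \<alpha> \<beta> \<gamma> = peirce_obstruction \<beta> \<alpha> (\<gamma> :: 'k)"
  by (simp add: peirce_obstruction_def algebra_simps)

text \<open>
  Containment in \<open>A\<^sub>0\<close>, and not vanishing, is what the second-order part yields uniformly: the
  obstruction at the 0-component is \<open>-20\<close>, which is 0 in characteristic 5.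
\<close>

lemma Al_Al'_in_A0:
  assumes "mul e u = scale l u" "weight u = 0" "mul e v = scale l' v" "weight v = 0"
  shows "mul e (mul u v) = 0"
proof (cases "(3::'k) = 0")
  case True
  then show ?thesis
    using char_3_eigenvector_zero assms by fastforce
next
  case False
  then have "peirce_obstruction l l' l \<noteq> 0" "peirce_obstruction l l' l' \<noteq> 0"
    using obstruction_Al_Al'_nonzero swap.obstruction_Al_Al'_nonzero peirce_obstruction_commute by auto
  moreover from eigenvector_product_components[OF assms(2,4,1,3)]
  obtain a p q where "mul u v = a + p + q" "mul e a = 0" "peirce_obstruction l l' l = 0 \<or> p = 0"
      "peirce_obstruction l l' l' = 0 \<or> q = 0"
    by blast
  ultimately show ?thesis
    by simp
qed

text \<open>
  Let \<open>c = u v \<in> A\<^sub>0\<close>. Multiplication by \<open>x = w e + a + u + v\<close> kills \<open>a\<close> and \<open>c\<close> and maps the span of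
  \<open>e\<close>, \<open>u\<close>, \<open>v\<close>, \<open>c\<close> into itself, so the equation can be checked on four coordinates.
\<close>

theorem train_equation:
  "ppow mul x 5 - scale (1/2 * weight x) (ppow mul x 4) + scale (weight x ^ 2) (ppow mul x 3)
     - scale (3/2 * weight x ^ 3) (ppow mul x 2) = 0"
proof -
  define w where "w = weight x"
  have "weight (x - scale w e) = 0"
    using weight_add[of "x - scale w e" "scale w e"] by (simp add: w_def weight_scale weight_e)
  then obtain a u v where a: "mul e a = 0" "weight a = 0" and u: "mul e u = scale l u" "weight u = 0"
    and v: "mul e v = scale l' v" "weight v = 0" and xauv: "x - scale w e = a + u + v"
    using kernel_decomposition by blast
  define c where "c = mul u v"
  have c: "mul e c = 0" "weight c = 0"
    using Al_Al'_in_A0 u v by (simp_all add: c_def weight_mul)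
  define f where "f p q r t = scale p e + scale q u + scale r v + scale t c" for p q r t
  have x: "x = f w 1 1 0 + a"
    using xauv by (simp add: f_def algebra_simps)
  have sum_of_parts: "mul x y = scale w (mul e y) + mul u y + mul v y + mul a y" for y
    using arg_cong[OF x, of "\<lambda>z. mul z y"] by (simp add: f_def mul_linear)
  have mul_x_e: "mul x e = scale w e + scale l u + scale l' v"
    unfolding sum_of_parts by (simp add: idempotent u v a mul_commute[of u e] mul_commute[of v e] mul_commute[of a e])
  have mul_x_u: "mul x u = scale (w * l) u + c"
    unfolding sum_of_parts
    by (simp add: u Al_square_zero[OF u] A0_Al_zero[OF a u] mul_commute[of v u] c_def)
  have mul_x_v: "mul x v = scale (w * l') v + c"
    unfolding sum_of_parts
    by (simp add: v swap.Al_square_zero[OF v] swap.A0_Al_zero[OF a v] c_def)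
  have mul_x_c: "mul x c = 0"
    unfolding sum_of_parts
    by (simp add: c A0_Al_zero[OF c u] swap.A0_Al_zero[OF c v] A0_A0_zero[OF a c] mul_commute[of u c] mul_commute[of v c])
  have mul_x_a: "mul x a = 0"
    unfolding sum_of_parts
    by (simp add: a A0_Al_zero[OF a u] swap.A0_Al_zero[OF a v] A0_A0_zero[OF a a] mul_commute[of u a] mul_commute[of v a])
  have mul_x: "mul x (f p q r t) = f (w * p) ((p + w * q) * l) ((p + w * r) * l') (q + r)" for p q r t
    unfolding f_def mul_add_right mul_scale_right mul_x_e mul_x_u mul_x_v mul_x_c
    by (rule eq_if_linear_functionals_eq) (simp add: algebra_simps)
  have "mul x x = mul x (f w 1 1 0) + mul x a"
    using arg_cong[OF x, of "mul x"] by (simp only: mul_add_right)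
  then have x2: "mul x x = f (w^2) (2 * w * l) (2 * w * l') 2"
    unfolding mul_x mul_x_a by (simp add: power2_eq_square)
  have powers: "w * w^2 = w^3" "w * w^3 = w^4" "w * w^4 = w^5"
    by (simp_all add: eval_nat_numeral)
  have "(w^2 + w * (2 * w * l)) * l = - 3 * w^2" "(w^2 + w * (2 * w * l')) * l' = - 3 * w^2"
      "2 * w * l + 2 * w * l' = - w"
    by - (use eigenvalue_sum eigenvalue_product in algebra)+
  then have x3: "mul x (mul x x) = f (w^3) (- 3 * w^2) (- 3 * w^2) (- w)"
    unfolding x2 mul_x powers by (simp only:)
  have "(w^3 + w * (- 3 * w^2)) * k = - 2 * w^3 * k" "- 3 * w^2 + - 3 * w^2 = - 6 * w^2" for k
    by (simp_all add: eval_nat_numeral algebra_simps)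
  then have x4: "mul x (mul x (mul x x)) = f (w^4) (- 2 * w^3 * l) (- 2 * w^3 * l') (- 6 * w^2)"
    unfolding x3 mul_x powers by (simp only:)
  have "(w^4 + w * (- 2 * w^3 * l)) * l = w^4 * (2 * l + 3)"
      "(w^4 + w * (- 2 * w^3 * l')) * l' = w^4 * (2 * l' + 3)"
      "- 2 * w^3 * l + - 2 * w^3 * l' = w^3"
    by - (use eigenvalue_sum eigenvalue_product in algebra)+
  then have x5: "mul x (mul x (mul x (mul x x))) = f (w^5) (w^4 * (2 * l + 3)) (w^4 * (2 * l' + 3)) (w^3)"
    unfolding x4 mul_x powers by (simp only:)
  have f_linear: "scale k (f p q r t) = f (k * p) (k * q) (k * r) (k * t)"
      "f p q r t + f p' q' r' t' = f (p + p') (q + q') (r + r') (t + t')"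
      "f p q r t - f p' q' r' t' = f (p - p') (q - q') (r - r') (t - t')" for k p q r t p' q' r' t'
    by (simp_all add: f_def scale_left_distrib scale_left_diff_distrib scale_right_distrib)
  have f_zero: "f p q r t = 0" if "p = 0" "q = 0" "r = 0" "t = 0" for p q r t
    by (simp add: f_def that)
  show ?thesis
    unfolding ppow_unfold w_def[symmetric] unfolding x5 unfolding x4 unfolding x3 unfolding x2
    unfolding f_linear
    by (rule f_zero; use two_nonzero in \<open>simp add: field_simps eval_nat_numeral\<close>)
qed

end

section \<open>From the Peirce decomposition to the train identity\<close>

lemma direct_sum_of_five:
  assumes "is_direct_sum [V1, V2, V3, V4, V5]"
  shows "\<exists>v1\<in>V1. \<exists>v2\<in>V2. \<exists>v3\<in>V3. \<exists>v4\<in>V4. \<exists>v5\<in>V5. x = v1 + v2 + v3 + v4 + v5"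
    and "\<lbrakk>v1 \<in> V1; v2 \<in> V2; v3 \<in> V3; v4 \<in> V4; v5 \<in> V5; 0 \<in> V1; 0 \<in> V2; 0 \<in> V3; 0 \<in> V4; 0 \<in> V5;
      v1 + v2 + v3 + v4 + v5 = 0\<rbrakk> \<Longrightarrow> v1 = 0 \<and> v2 = 0 \<and> v3 = 0 \<and> v4 = 0 \<and> v5 = 0"
proof -
  have "\<exists>vs. list_all2 (\<lambda>v V. v \<in> V) vs [V1, V2, V3, V4, V5] \<and> sum_list vs = x"
    using assms unfolding is_direct_sum_def by blast
  then obtain v1 v2 v3 v4 v5 where "v1 \<in> V1" "v2 \<in> V2" "v3 \<in> V3" "v4 \<in> V4" "v5 \<in> V5"
      "sum_list [v1, v2, v3, v4, v5] = x"
    by (auto simp only: list_all2_Cons2 list_all2_Nil2)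
  moreover from this(6) have "x = v1 + v2 + v3 + v4 + v5"
    by (simp add: add.assoc)
  ultimately show "\<exists>v1\<in>V1. \<exists>v2\<in>V2. \<exists>v3\<in>V3. \<exists>v4\<in>V4. \<exists>v5\<in>V5. x = v1 + v2 + v3 + v4 + v5"
    by blast
next
  assume "v1 \<in> V1" "v2 \<in> V2" "v3 \<in> V3" "v4 \<in> V4" "v5 \<in> V5" "0 \<in> V1" "0 \<in> V2" "0 \<in> V3" "0 \<in> V4" "0 \<in> V5"
    "v1 + v2 + v3 + v4 + v5 = 0"
  then have "list_all2 (\<lambda>v V. v \<in> V) [v1, v2, v3, v4, v5] [V1, V2, V3, V4, V5] \<and> sum_list [v1, v2, v3, v4, v5] = 0"
    and "list_all2 (\<lambda>v V. v \<in> V) [0, 0, 0, 0, 0] [V1, V2, V3, V4, V5] \<and> sum_list [0, 0, 0, 0, 0 :: 'a] = 0"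
    by (simp_all add: add.assoc)
  then have "[v1, v2, v3, v4, v5] = [0, 0, 0, 0, 0]"
    using assms unfolding is_direct_sum_def by blast
  then show "v1 = 0 \<and> v2 = 0 \<and> v3 = 0 \<and> v4 = 0 \<and> v5 = 0"
    by simp
qed

text \<open>
  The rank is the least degree of a train identity, so the existence of one identity suffices and the
  rank need not be known.
\<close>

lemma principal_train_algebra_if_train_identity:
  assumes "baric_algebra scale mul weight" "2 \<le> n" "train_identity scale mul weight n \<gamma>"
  shows "principal_train_algebra scale mul weight"
proof -
  let ?P = "\<lambda>n. 2 \<le> n \<and> (\<exists>\<gamma>. train_identity scale mul weight n \<gamma>)"
  have "?P (LEAST n. ?P n)"
    by (rule LeastI[of ?P n]) (use assms in blast)
  moreover have "\<not> ?P m" if "m < (LEAST n. ?P n)" for m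
    using not_less_Least[OF that] .
  ultimately show ?thesis
    unfolding principal_train_algebra_def principal_train_algebra_of_rank_def
    using assms(1) by blast
qed

lemma of_nat_prime_nonzero:
  assumes "prime p" "CHAR('k::field) \<noteq> p"
  shows "of_nat p \<noteq> (0::'k)"
proof
  assume "of_nat p = (0::'k)"
  then have "CHAR('k) dvd p"
    by (simp add: of_nat_eq_0_iff_char_dvd)
  then have "CHAR('k) = 1"
    using assms unfolding prime_nat_iff by blast
  then show False
    by simp
qed

theorem proposition5p1:
  fixes scale :: "'k::alg_closed_field \<Rightarrow> 'a::ab_group_add \<Rightarrow> 'a"
    and mul :: "'a \<Rightarrow> 'a \<Rightarrow> 'a"
    and weight :: "'a \<Rightarrow> 'k"
    and e :: 'a
    and s l l' :: 'k
  assumes "CHAR('k) \<noteq> 2"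
    and "CHAR('k) \<noteq> 163"
    and "s ^ 2 = - 23"
    and "l = (- 1 - s) / 4"
    and "l' = (- 1 + s) / 4"
    and "baric_algebra scale mul weight"
    and "\<And>x. scale 2 (mul (ppow mul x 2) (ppow mul x 4))
           = scale (weight x ^ 2) (ppow mul x 4) + scale (weight x ^ 4) (ppow mul x 2)"
    and "e \<noteq> 0"
    and "mul e e = e"
    and "peirce_decomposition scale mul weight e l l'"
    and "peirce_space scale mul weight e (1/2) = {0}"
  shows "principal_train_algebra scale mul weight \<and>
    (\<forall>x. ppow mul x 5 - scale (1/2 * weight x) (ppow mul x 4)
         + scale (weight x ^ 2) (ppow mul x 3)
         - scale (3/2 * weight x ^ 3) (ppow mul x 2) = 0)"
proof -
  note two = assms(1) and n163 = assms(2) and s = assms(3) and l = assms(4) and l' = assms(5)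
    and identity = assms(7)
  interpret baric_algebra scale mul weight
    by fact
  have two_nonzero: "(2::'k) \<noteq> 0"
    using of_nat_prime_nonzero[of 2, where 'k = 'k] two by simp
  have nonzero_163: "(163::'k) \<noteq> 0"
    using of_nat_prime_nonzero[of 163, where 'k = 'k] n163 by simp
  have "(4::'k) = 2 * 2"
    by simp
  then have four_nonzero: "(4::'k) \<noteq> 0"
    using two_nonzero mult_eq_0_iff[of "2::'k" 2] by (simp only: simp_thms)
  have eigenvalues: "l * 4 = - 1 - s" "l' * 4 = - 1 + s"
    using l l' unfolding nonzero_eq_divide_eq[OF four_nonzero] .
  have "2 * (2 * (l + l')) = 2 * (- 1)"
    using eigenvalues by algebra
  then have eigenvalue_sum: "2 * (l + l') = - 1"
    using two_nonzero by (simp only: mult_cancel_left) blast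
  have "8 * (2 * (l * l')) = 8 * 3"
    using eigenvalues s by algebra
  moreover have "(8::'k) = 2 * 4"
    by simp
  then have "(8::'k) \<noteq> 0"
    using two_nonzero four_nonzero mult_eq_0_iff[of "2::'k" 4] by (simp only: simp_thms)
  ultimately have eigenvalue_product: "2 * (l * l') = 3"
    using mult_left_cancel[of "8::'k"] by blast
  have "weight e * weight e = weight e"
    using weight_mul[of e e] assms(9) by simp
  \<comment> \<open>At an idempotent of weight 0 the identity reads \<open>2 e = 0\<close>.\<close>
  moreover have "weight e \<noteq> 0"
  proof
    assume "weight e = 0"
    then have "scale 2 e = 0"
      using identity[of e] assms(9) by (simp add: ppow_unfold)
    then show False
      using two_nonzero assms(8) by simp
  qed
  ultimately have weight_e: "weight e = 1"
    by simp
  define V where "V = peirce_space scale mul weight e"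
  have V: "x \<in> V \<alpha> \<longleftrightarrow> weight x = 0 \<and> mul e x = scale \<alpha> x" for x \<alpha>
    by (simp add: V_def peirce_space_def)
  have direct: "is_direct_sum [range (\<lambda>c. scale c e), V 0, V (1/2), V l, V l']"
    using assms(10) by (simp add: peirce_decomposition_def V_def)
  have half: "V (1/2) = {0}"
    using assms(11) by (simp add: V_def)
  interpret half_free_2_4_algebra scale mul weight e l l'
  proof unfold_locales
    fix x assume x: "weight x = 0"
    obtain y a h u v where "y \<in> range (\<lambda>c. scale c e)" "h \<in> V (1/2)" "x = y + a + h + u + v"
      and auv: "a \<in> V 0" "u \<in> V l" "v \<in> V l'"
      using direct_sum_of_five(1)[OF direct, of x] by blast
    moreover from this obtain c where "y = scale c e"
      by blast
    ultimately have x_eq: "x = scale c e + a + u + v"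
      by (simp add: half)
    \<comment> \<open>The weight reads off the \<open>e\<close>-coordinate, which is 0 here.\<close>
    have "weight x = c"
      using auv unfolding x_eq weight_add weight_scale weight_e V by simp
    then have "x = a + u + v"
      using x x_eq by simp
    then show "\<exists>a u v. mul e a = 0 \<and> mul e u = scale l u \<and> mul e v = scale l' v \<and>
        weight a = 0 \<and> weight u = 0 \<and> weight v = 0 \<and> x = a + u + v"
      using auv by (intro exI[of _ a] exI[of _ u] exI[of _ v]) (simp add: V)
  next
    fix a u v
    assume "mul e a = 0" "mul e u = scale l u" "mul e v = scale l' v" "weight a = 0" "weight u = 0"
      "weight v = 0" "a + u + v = 0"
    then have "a \<in> V 0" "u \<in> V l" "v \<in> V l'" "0 + a + 0 + u + v = 0"
      by (simp_all add: V)
    moreover have "0 \<in> V \<alpha>" for \<alpha>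
      by (simp add: V)
    moreover have "0 \<in> range (\<lambda>c. scale c e)"
      by (rule range_eqI[of _ _ 0]) simp
    ultimately show "a = 0 \<and> u = 0 \<and> v = 0"
      using direct_sum_of_five(2)[OF direct, of 0 a 0 u v] by blast
  next
    show "scale 2 (mul (ppow mul x 2) (ppow mul x 4))
        = scale (weight x ^ 2) (ppow mul x 4) + scale (weight x ^ 4) (ppow mul x 2)" for x
      by (rule identity)
    show "infinite (UNIV :: 'k set)"
      by (rule infinite_UNIV_alg_closed_field)
    show "mul e e = e" "weight e = 1" "(2::'k) \<noteq> 0" "(163::'k) \<noteq> 0"
        "2 * (l + l') = - 1" "2 * (l * l') = 3"
      by fact+
  qed
  have train: "ppow mul x 5 - scale (1/2 * weight x) (ppow mul x 4)
         + scale (weight x ^ 2) (ppow mul x 3)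
         - scale (3/2 * weight x ^ 3) (ppow mul x 2) = 0" for x
    by (rule train_equation)
  \<comment> \<open>The entry at index 0 is a dummy: train coefficients are counted from 1.\<close>
  define \<gamma> :: "nat \<Rightarrow> 'k" where "\<gamma> = (\<lambda>i. [0, - (1/2), 1, - (3/2), 0] ! i)"
  have "train_identity scale mul weight 5 \<gamma>"
    unfolding train_identity_def
  proof
    fix x
    have "{Suc 0..4} = {1, 2, 3, 4}"
      by auto
    then show "ppow mul x 5 + (\<Sum>i = 1..5 - 1. scale (\<gamma> i * weight x ^ i) (ppow mul x (5 - i))) = 0"
      using train[of x] by (simp add: \<gamma>_def) (simp add: algebra_simps)
  qed
  then have "principal_train_algebra scale mul weight"
    by (rule principal_train_algebra_if_train_identity[OF baric_algebra_axioms, rotated]) simp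
  with train show ?thesis
    by blast
qed

end
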